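(* Let $(C_{\mathcal{A}},h,\nabla)$ and $(C_{\mathcal{A}'},h',\nabla')$ be pseudo-Riemannian calculi, with $C_{\mathcal{A}}=(\mathcal{A},\mathfrak{g},M,\varphi)$ and $C_{\mathcal{A}'}=(\mathcal{A}',\mathfrak{g}',M',\varphi')$, and let $(\phi,\psi,\widehat{\psi}):(C_{\mathcal{A}},h)\to(C_{\mathcal{A}'},h')$ be an isometric embedding. Let $\alpha:\mathfrak{g}'\times M_\Psi\to M_\Psi^\perp$, $\alpha(\delta,m)=\Pi(\nabla_{\psi(\delta)}m)$, be the second fundamental form, where $\Pi:M\to M_\Psi^\perp$ is the projection with respect to $M=M_\Psi\oplus M_\Psi^\perp$. If $\delta_1,\delta_2\in\mathfrak{g}'$, $a_1,a_2\in\mathcal{A}$ and $\lambda_1,\lambda_2\in\mathbb{R}$, then $$\alpha(\delta_1,\Psi(\delta_2))=\alpha(\delta_2,\Psi(\delta_1)),$$ $$\alpha(\lambda_1\delta_1+\lambda_2\delta_2,m_1)=\lambda_1\alpha(\delta_1,m_1)+\lambda_2\alpha(\delta_2,m_1),$$ $$\alpha(\delta_1,m_1a_1+m_2a_2)=\alpha(\delta_1,m_1)a_1+\alpha(\delta_1,m_2)a_2$$ for $m_1,m_2\in M_\Psi$.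
   Context: Algebras are over $\mathbb{C}$. A real calculus is a tuple $C_{\mathcal{A}}=(\mathcal{A},\mathfrak{g},M,\varphi)$ where $\mathcal{A}$ is a unital $\ast$-algebra, $\mathfrak{g}\subseteq \mathrm{Der}(\mathcal{A})$ is a finite-dimensional real Lie algebra of derivations, $M$ is a right $\mathcal{A}$-module, and $\varphi:\mathfrak{g}\to M$ is an $\mathbb{R}$-linear map whose image generates $M$ as an $\mathcal{A}$-module. A metric on $M$ is a map $h:M\times M\to\mathcal{A}$, additive in the second argument, with $h(m_1,m_2a)=h(m_1,m_2)a$, $h(m_1,m_2)=h(m_2,m_1)^*$, and non-degenerate: $h(m_1,m_2)=0$ for all $m_2$ implies $m_1=0$. A real metric calculus $(C_{\mathcal{A}},h)$ is a real calculus with a metric $h$ on $M$ such that $h(\varphi(\partial_1),\varphi(\partial_2))^*=h(\varphi(\partial_1),\varphi(\partial_2))$ for all $\partial_1,\partial_2\in\mathfrak{g}$. An affine connection on $(M,\mathfrak{g})$ is a map $\nabla:\mathfrak{g}\times M\to M$, $(\partial,m)\mapsto\nabla_\partial m$, additive in $m$, $\mathbb{R}$-linear in $\partial$, with $\nabla_\partial(ma)=(\nabla_\partial m)a+m\,\partial(a)$. $(C_{\mathcal{A}},h,\nabla)$ is a pseudo-Riemannian calculus if for all $\partial,\partial_1,\partial_2\in\mathfrak{g}$, $m,n\in M$: $h(\nabla_\partial\varphi(\partial_1),\varphi(\partial_2))$ is hermitian (equal to its own $\ast$); $\partial(h(m,n))=h(\nabla_\partial m,n)+h(m,\nabla_\partial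 n)$; and $\nabla_{\partial_1}\varphi(\partial_2)-\nabla_{\partial_2}\varphi(\partial_1)-\varphi([\partial_1,\partial_2])=0$. A real calculus homomorphism $(\phi,\psi,\widehat{\psi}):C_{\mathcal{A}}\to C_{\mathcal{A}'}$ consists of: a $\ast$-algebra homomorphism $\phi:\mathcal{A}\to\mathcal{A}'$; a Lie algebra homomorphism $\psi:\mathfrak{g}'\to\mathfrak{g}$ with $\delta(\phi(a))=\phi(\psi(\delta)(a))$ for all $\delta\in\mathfrak{g}'$, $a\in\mathcal{A}$; and, setting $\Psi=\varphi\circ\psi$ and letting $M_\Psi$ be the submodule of $M$ generated by $\Psi(\mathfrak{g}')$, a map $\widehat{\psi}:M_\Psi\to M'$ that is additive, satisfies $\widehat{\psi}(ma)=\widehat{\psi}(m)\phi(a)$ for $m\in M_\Psi$, $a\in\mathcal{A}$, and $\widehat{\psi}(\Psi(\delta))=\varphi'(\delta)$ for all $\delta\in\mathfrak{g}'$. It is an isometric embedding $(C_{\mathcal{A}},h)\to(C_{\mathcal{A}'},h')$ of real metric calculi if $h'(\varphi'(\delta_1),\varphi'(\delta_2))=\phi(h(\Psi(\delta_1),\Psi(\delta_2)))$ for all $\delta_1,\delta_2\in\mathfrak{g}'$, $\phi$ is surjective, and $M=M_\Psi\oplus M_\Psi^\perp$, where $M_\Psi^\perp=\{m\in M: h(m,n)=0\text{ for all }n\in M_\Psi\}$. *)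

theory Defs
  imports Complex_Main "HOL-Library.Function_Algebras"
begin

section \<open>Unital *-algebras and their derivations\<close>

text \<open>
  The class is built on \<open>ring + monoid_mult\<close> instead of \<open>ring_1\<close>, because the latter
  contains the axiom \<open>0 \<noteq> 1\<close> and so excludes the zero algebra.
\<close>

class star_algebra = ring + monoid_mult +
  fixes scaleC :: "complex \<Rightarrow> 'a \<Rightarrow> 'a"
    and star :: "'a \<Rightarrow> 'a"
  assumes scaleC_add_right: "scaleC c (x + y) = scaleC c x + scaleC c y"
    and scaleC_add_left: "scaleC (c + d) x = scaleC c x + scaleC d x"
    and scaleC_scaleC: "scaleC c (scaleC d x) = scaleC (c * d) x"
    and scaleC_one: "scaleC 1 x = x"
    and scaleC_mult_left: "scaleC c x * y = scaleC c (x * y)"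
    and scaleC_mult_right: "x * scaleC c y = scaleC c (x * y)"
    and star_add: "star (x + y) = star x + star y"
    and star_scaleC: "star (scaleC c x) = scaleC (cnj c) (star x)"
    and star_mult: "star (x * y) = star y * star x"
    and star_star: "star (star x) = x"

definition hermitian :: "'a::star_algebra \<Rightarrow> bool" where
  "hermitian a \<longleftrightarrow> star a = a"

definition derivation :: "('a::star_algebra \<Rightarrow> 'a) \<Rightarrow> bool" where
  "derivation d \<longleftrightarrow>
     (\<forall>a b. d (a + b) = d a + d b) \<and>
     (\<forall>c a. d (scaleC c a) = scaleC c (d a)) \<and>
     (\<forall>a b. d (a * b) = d a * b + a * d b)"

definition der_scale :: "real \<Rightarrow> ('a::star_algebra \<Rightarrow> 'a) \<Rightarrow> ('a \<Rightarrow> 'a)" where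
  "der_scale r d = (\<lambda>a. scaleC (of_real r) (d a))"

definition der_bracket :: "('a::star_algebra \<Rightarrow> 'a) \<Rightarrow> ('a \<Rightarrow> 'a) \<Rightarrow> ('a \<Rightarrow> 'a)" where
  "der_bracket d1 d2 = (\<lambda>a. d1 (d2 a) - d2 (d1 a))"

text \<open>The real vector space of all maps from the algebra to itself, with pointwise operations.\<close>

global_interpretation der: vector_space "der_scale :: real \<Rightarrow> ('a::star_algebra \<Rightarrow> 'a) \<Rightarrow> _"
  by unfold_locales
    (simp_all add: der_scale_def fun_eq_iff scaleC_add_right scaleC_add_left scaleC_scaleC scaleC_one)

definition lie_algebra_of_derivations :: "('a::star_algebra \<Rightarrow> 'a) set \<Rightarrow> bool" where
  "lie_algebra_of_derivations \<gg> \<longleftrightarrow>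
     (\<forall>d\<in>\<gg>. derivation d) \<and>
     der.subspace \<gg> \<and>
     (\<exists>B. finite B \<and> der.span B = \<gg>) \<and>
     (\<forall>d1\<in>\<gg>. \<forall>d2\<in>\<gg>. der_bracket d1 d2 \<in> \<gg>)"

definition real_linear_on ::
  "'v::ab_group_add set \<Rightarrow> (real \<Rightarrow> 'v \<Rightarrow> 'v) \<Rightarrow> (real \<Rightarrow> 'w::ab_group_add \<Rightarrow> 'w) \<Rightarrow> ('v \<Rightarrow> 'w) \<Rightarrow> bool"
where
  "real_linear_on V sV sW f \<longleftrightarrow>
     (\<forall>x\<in>V. \<forall>y\<in>V. f (x + y) = f x + f y) \<and>
     (\<forall>r. \<forall>x\<in>V. f (sV r x) = sW r (f x))"


section \<open>Real calculi\<close>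

text \<open>
  The algebra and the underlying additive group of the module are the types \<open>'a\<close> and \<open>'m\<close>; the
  record holds the remaining data.  Maps with domain a proper subset of a type are total functions
  of which only the values on that subset are constrained or used.
\<close>

record ('a, 'm) calculus =
  ders :: "('a \<Rightarrow> 'a) set"
  act :: "'m \<Rightarrow> 'a \<Rightarrow> 'm"  (infixl "\<cdot>\<index>" 70)
  vphi :: "('a \<Rightarrow> 'a) \<Rightarrow> 'm"

text \<open>A module over a unital complex algebra is a real vector space via \<open>r m = m (r 1)\<close>.\<close>

definition mscale :: "('a::star_algebra, 'm) calculus \<Rightarrow> real \<Rightarrow> 'm \<Rightarrow> 'm" where
  "mscale C r m = m \<cdot>\<^bsub>C\<^esub> scaleC (of_real r) 1"

definition submodule :: "('a, 'm::ab_group_add) calculus \<Rightarrow> 'm set \<Rightarrow> bool" where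
  "submodule C N \<longleftrightarrow>
     0 \<in> N \<and> (\<forall>m\<in>N. \<forall>n\<in>N. m + n \<in> N) \<and> (\<forall>m\<in>N. - m \<in> N) \<and> (\<forall>m\<in>N. \<forall>a. m \<cdot>\<^bsub>C\<^esub> a \<in> N)"

definition submodule_generated :: "('a, 'm::ab_group_add) calculus \<Rightarrow> 'm set \<Rightarrow> 'm set" where
  "submodule_generated C S = \<Inter>{N. submodule C N \<and> S \<subseteq> N}"

locale real_calculus =
  fixes C :: "('a::star_algebra, 'm::ab_group_add) calculus" (structure)
  assumes act_add_left: "(m + n) \<cdot> a = m \<cdot> a + n \<cdot> a"
    and act_add_right: "m \<cdot> (a + b) = m \<cdot> a + m \<cdot> b"
    and act_mult: "m \<cdot> (a * b) = (m \<cdot> a) \<cdot> b"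
    and act_one: "m \<cdot> 1 = m"
    and ders_lie: "lie_algebra_of_derivations (ders C)"
    and vphi_linear: "real_linear_on (ders C) der_scale (mscale C) (vphi C)"
    and vphi_generates: "submodule_generated C (vphi C ` ders C) = UNIV"

locale real_metric_calculus = real_calculus C
  for C :: "('a::star_algebra, 'm::ab_group_add) calculus" (structure) +
  fixes h :: "'m \<Rightarrow> 'm \<Rightarrow> 'a"
  assumes metric_add: "h m (n1 + n2) = h m n1 + h m n2"
    and metric_act: "h m (n \<cdot> a) = h m n * a"
    and metric_star: "h m n = star (h n m)"
    and metric_nondegenerate: "(\<forall>n. h m n = 0) \<Longrightarrow> m = 0"
    and metric_hermitian:
      "\<lbrakk>d1 \<in> ders C; d2 \<in> ders C\<rbrakk> \<Longrightarrow> hermitian (h (vphi C d1) (vphi C d2))"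

locale affine_connection = real_calculus C
  for C :: "('a::star_algebra, 'm::ab_group_add) calculus" (structure) +
  fixes nabla :: "('a \<Rightarrow> 'a) \<Rightarrow> 'm \<Rightarrow> 'm"
  assumes nabla_add: "d \<in> ders C \<Longrightarrow> nabla d (m + n) = nabla d m + nabla d n"
    and nabla_linear: "real_linear_on (ders C) der_scale (mscale C) (\<lambda>d. nabla d m)"
    and nabla_act: "d \<in> ders C \<Longrightarrow> nabla d (m \<cdot> a) = nabla d m \<cdot> a + m \<cdot> d a"

locale pseudo_riemannian_calculus = real_metric_calculus C h + affine_connection C nabla
  for C :: "('a::star_algebra, 'm::ab_group_add) calculus" (structure)
    and h :: "'m \<Rightarrow> 'm \<Rightarrow> 'a"
    and nabla :: "('a \<Rightarrow> 'a) \<Rightarrow> 'm \<Rightarrow> 'm" +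
  assumes nabla_hermitian:
      "\<lbrakk>d \<in> ders C; d1 \<in> ders C; d2 \<in> ders C\<rbrakk>
        \<Longrightarrow> hermitian (h (nabla d (vphi C d1)) (vphi C d2))"
    and nabla_metric: "d \<in> ders C \<Longrightarrow> d (h m n) = h (nabla d m) n + h m (nabla d n)"
    and nabla_torsion_free:
      "\<lbrakk>d1 \<in> ders C; d2 \<in> ders C\<rbrakk>
        \<Longrightarrow> nabla d1 (vphi C d2) - nabla d2 (vphi C d1) - vphi C (der_bracket d1 d2) = 0"


section \<open>Homomorphisms and isometric embeddings\<close>

definition star_algebra_hom :: "('a::star_algebra \<Rightarrow> 'b::star_algebra) \<Rightarrow> bool" where
  "star_algebra_hom f \<longleftrightarrow>
     (\<forall>a b. f (a + b) = f a + f b) \<and>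
     (\<forall>c a. f (scaleC c a) = scaleC c (f a)) \<and>
     (\<forall>a b. f (a * b) = f a * f b) \<and>
     (\<forall>a. f (star a) = star (f a))"

definition lie_hom_on ::
  "('b::star_algebra \<Rightarrow> 'b) set \<Rightarrow> ('a::star_algebra \<Rightarrow> 'a) set \<Rightarrow> (('b \<Rightarrow> 'b) \<Rightarrow> ('a \<Rightarrow> 'a)) \<Rightarrow> bool"
where
  "lie_hom_on \<gg>' \<gg> \<psi> \<longleftrightarrow>
     \<psi> ` \<gg>' \<subseteq> \<gg> \<and>
     real_linear_on \<gg>' der_scale der_scale \<psi> \<and>
     (\<forall>d1\<in>\<gg>'. \<forall>d2\<in>\<gg>'. \<psi> (der_bracket d1 d2) = der_bracket (\<psi> d1) (\<psi> d2))"

definition Psi ::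
  "('a, 'm) calculus \<Rightarrow> (('b \<Rightarrow> 'b) \<Rightarrow> ('a \<Rightarrow> 'a)) \<Rightarrow> ('b \<Rightarrow> 'b) \<Rightarrow> 'm"
where
  "Psi C \<psi> = vphi C \<circ> \<psi>"

definition M_Psi ::
  "('a, 'm::ab_group_add) calculus \<Rightarrow> ('b, 'n) calculus \<Rightarrow> (('b \<Rightarrow> 'b) \<Rightarrow> ('a \<Rightarrow> 'a)) \<Rightarrow> 'm set"
where
  "M_Psi C C' \<psi> = submodule_generated C (Psi C \<psi> ` ders C')"

definition orth_compl :: "('m \<Rightarrow> 'm \<Rightarrow> 'a::zero) \<Rightarrow> 'm set \<Rightarrow> 'm set" where
  "orth_compl h N = {m. \<forall>n\<in>N. h m n = 0}"

definition direct_sum_decomposition :: "'m::ab_group_add set \<Rightarrow> 'm set \<Rightarrow> bool" where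
  "direct_sum_decomposition N P \<longleftrightarrow> (\<forall>m. \<exists>n\<in>N. \<exists>p\<in>P. m = n + p) \<and> N \<inter> P = {0}"

text \<open>The component in \<open>P\<close> of \<open>m\<close> with respect to a direct sum of \<open>N\<close> and \<open>P\<close>.\<close>

definition projection :: "'m::ab_group_add set \<Rightarrow> 'm set \<Rightarrow> 'm \<Rightarrow> 'm" where
  "projection N P m = (THE p. p \<in> P \<and> (\<exists>n\<in>N. m = n + p))"

locale real_calculus_hom = source: real_calculus C + target: real_calculus C'
  for C :: "('a::star_algebra, 'm::ab_group_add) calculus"
    and C' :: "('b::star_algebra, 'n::ab_group_add) calculus" +
  fixes \<phi> :: "'a \<Rightarrow> 'b"
    and \<psi> :: "('b \<Rightarrow> 'b) \<Rightarrow> ('a \<Rightarrow> 'a)"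
    and psihat :: "'m \<Rightarrow> 'n"
  assumes phi_hom: "star_algebra_hom \<phi>"
    and psi_hom: "lie_hom_on (ders C') (ders C) \<psi>"
    and phi_psi: "\<delta> \<in> ders C' \<Longrightarrow> \<delta> (\<phi> a) = \<phi> (\<psi> \<delta> a)"
    and psihat_add:
      "\<lbrakk>m \<in> M_Psi C C' \<psi>; n \<in> M_Psi C C' \<psi>\<rbrakk> \<Longrightarrow> psihat (m + n) = psihat m + psihat n"
    and psihat_act: "m \<in> M_Psi C C' \<psi> \<Longrightarrow> psihat (m \<cdot>\<^bsub>C\<^esub> a) = psihat m \<cdot>\<^bsub>C'\<^esub> \<phi> a"
    and psihat_Psi: "\<delta> \<in> ders C' \<Longrightarrow> psihat (Psi C \<psi> \<delta>) = vphi C' \<delta>"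

locale isometric_embedding =
  real_calculus_hom C C' \<phi> \<psi> psihat +
  source: real_metric_calculus C h + target: real_metric_calculus C' h'
  for C :: "('a::star_algebra, 'm::ab_group_add) calculus"
    and h :: "'m \<Rightarrow> 'm \<Rightarrow> 'a"
    and C' :: "('b::star_algebra, 'n::ab_group_add) calculus"
    and h' :: "'n \<Rightarrow> 'n \<Rightarrow> 'b"
    and \<phi> :: "'a \<Rightarrow> 'b"
    and \<psi> :: "('b \<Rightarrow> 'b) \<Rightarrow> ('a \<Rightarrow> 'a)"
    and psihat :: "'m \<Rightarrow> 'n" +
  assumes isometric:
      "\<lbrakk>\<delta>1 \<in> ders C'; \<delta>2 \<in> ders C'\<rbrakk>
        \<Longrightarrow> h' (vphi C' \<delta>1) (vphi C' \<delta>2) = \<phi> (h (Psi C \<psi> \<delta>1) (Psi C \<psi> \<delta>2))"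
    and phi_surj: "surj \<phi>"
    and orthogonal_decomposition:
      "direct_sum_decomposition (M_Psi C C' \<psi>) (orth_compl h (M_Psi C C' \<psi>))"

definition second_fundamental_form ::
  "('a, 'm::ab_group_add) calculus \<Rightarrow> ('m \<Rightarrow> 'm \<Rightarrow> 'a::star_algebra) \<Rightarrow> (('a \<Rightarrow> 'a) \<Rightarrow> 'm \<Rightarrow> 'm) \<Rightarrow>
   ('b, 'n) calculus \<Rightarrow> (('b \<Rightarrow> 'b) \<Rightarrow> ('a \<Rightarrow> 'a)) \<Rightarrow> ('b \<Rightarrow> 'b) \<Rightarrow> 'm \<Rightarrow> 'm"
where
  "second_fundamental_form C h nabla C' \<psi> \<delta> m =
     projection (M_Psi C C' \<psi>) (orth_compl h (M_Psi C C' \<psi>)) (nabla (\<psi> \<delta>) m)"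

end

theory Submission imports Defs begin

text \<open>
  The projection \<open>\<Pi>\<close> onto \<open>M\<^sub>\<Psi>\<^sup>\<bottom>\<close> is \<open>\<A>\<close>-linear and vanishes exactly on \<open>M\<^sub>\<Psi>\<close>. Modulo \<open>M\<^sub>\<Psi>\<close>,
  torsion-freeness makes \<open>\<nabla>\<^bsub>\<psi>(\<delta>1)\<^esub> \<Psi>(\<delta>2)\<close> symmetric, because the difference
  \<open>vphi([\<psi>(\<delta>1), \<psi>(\<delta>2)]) = \<Psi>([\<delta>1, \<delta>2])\<close> lies in \<open>M\<^sub>\<Psi>\<close>, and the Leibniz rule makes
  \<open>\<nabla>\<^bsub>\<psi>(\<delta>)\<^esub>\<close> linear over the algebra, because its derivative term \<open>m (\<psi>(\<delta>) a)\<close> lies in \<open>M\<^sub>\<Psi>\<close>.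
\<close>

lemma submodule_submodule_generated: "submodule C (submodule_generated C S)"
  unfolding submodule_def submodule_generated_def by auto

lemma submodule_generated_superset: "S \<subseteq> submodule_generated C S"
  unfolding submodule_generated_def by auto

lemma lie_algebra_of_derivations_scale:
  "\<lbrakk>lie_algebra_of_derivations \<gg>; d \<in> \<gg>\<rbrakk> \<Longrightarrow> der_scale r d \<in> \<gg>"
  unfolding lie_algebra_of_derivations_def by (blast intro: der.subspace_scale)

lemma lie_algebra_of_derivations_bracket:
  "\<lbrakk>lie_algebra_of_derivations \<gg>; d1 \<in> \<gg>; d2 \<in> \<gg>\<rbrakk> \<Longrightarrow> der_bracket d1 d2 \<in> \<gg>"
  unfolding lie_algebra_of_derivations_def by blast

text \<open>\<open>real_linear_on\<close> gives additivity only for arguments in \<gg>, so both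
  scaled derivations must first be seen to stay in \<gg>.\<close>

lemma real_linear_on_lincomb:
  assumes "real_linear_on \<gg> der_scale s f" "lie_algebra_of_derivations \<gg>" "d1 \<in> \<gg>" "d2 \<in> \<gg>"
  shows "f (der_scale r1 d1 + der_scale r2 d2) = s r1 (f d1) + s r2 (f d2)"
  using assms unfolding real_linear_on_def by (simp add: lie_algebra_of_derivations_scale)

context real_metric_calculus
begin

text \<open>The axioms govern the second slot of \<open>h\<close>, whereas \<open>orth_compl\<close>
  varies the first. Hermitian symmetry carries additivity over, and turns the action into left
  multiplication by \<open>star a\<close>.\<close>

lemma metric_add_left: "h (m1 + m2) n = h m1 n + h m2 n"
  by (metis metric_star metric_add star_add)

lemma metric_act_left: "h (m \<cdot> a) n = star a * h m n"
  by (metis metric_star metric_act star_mult)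

lemma submodule_orth_compl: "submodule C (orth_compl h N)"
proof -
  have zero: "h 0 n = 0" for n
    using metric_add_left[of 0 0 n] by simp
  have "h (- m) n = - h m n" for m n
    unfolding eq_neg_iff_add_eq_0 using metric_add_left[of "- m" m n] zero by simp
  then show ?thesis
    by (simp add: submodule_def orth_compl_def zero metric_add_left metric_act_left)
qed

end

text \<open>What is needed of the projection depends only on both summands being submodules, so the
  metric is left out here. Later \<open>N\<close> is \<open>M_Psi\<close> and \<open>P\<close> its
  orthogonal complement.\<close>

locale submodule_decomposition = real_calculus C
  for C :: "('a::star_algebra, 'm::ab_group_add) calculus" (structure) +
  fixes N P :: "'m set"
  assumes submodule_N: "submodule C N"
    and submodule_P: "submodule C P"
    and decomposition: "direct_sum_decomposition N P"
begin

text \<open>Two decompositions of \<open>m\<close> differ by an element of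
  \<open>N \<inter> P\<close>, which is 0. This removes the definite description: exhibiting one
  decomposition computes the projection.\<close>

lemma projection_eqI:
  assumes "n \<in> N" "p \<in> P" "m = n + p"
  shows "projection N P m = p"
  unfolding projection_def
proof (rule the_equality)
  show "p \<in> P \<and> (\<exists>n\<in>N. m = n + p)"
    using assms by blast
next
  fix q assume "q \<in> P \<and> (\<exists>n\<in>N. m = n + q)"
  then obtain n' where q: "q \<in> P" "n' \<in> N" "m = n' + q"
    by blast
  have "q = - n' + (n' + q)"
    by simp
  also have "n' + q = n + p"
    by (rule trans[OF q(3)[symmetric] assms(3)])
  finally have eq: "n + - n' = q + - p"
    by (simp add: algebra_simps)
  have "n + - n' \<in> N"
    using submodule_N assms(1) q(2) unfolding submodule_def by blast
  moreover have "q + - p \<in> P"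
    using submodule_P assms(2) q(1) unfolding submodule_def by blast
  ultimately have "q + - p \<in> N \<inter> P"
    using eq by simp
  then show "q = p"
    using decomposition unfolding direct_sum_decomposition_def by simp
qed

lemma decompose:
  obtains n where "n \<in> N" "projection N P m \<in> P" "m = n + projection N P m"
proof -
  obtain n p where np: "n \<in> N" "p \<in> P" "m = n + p"
    using decomposition unfolding direct_sum_decomposition_def by blast
  have "projection N P m = p"
    using np by (rule projection_eqI)
  from that[of n, unfolded this] np show thesis .
qed

lemma projection_add: "projection N P (m1 + m2) = projection N P m1 + projection N P m2"
proof -
  obtain n1 where 1: "n1 \<in> N" "projection N P m1 \<in> P" "m1 = n1 + projection N P m1"
    by (rule decompose)
  obtain n2 where 2: "n2 \<in> N" "projection N P m2 \<in> P" "m2 = n2 + projection N P m2"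
    by (rule decompose)
  show ?thesis
  proof (rule projection_eqI)
    show "n1 + n2 \<in> N"
      using submodule_N 1 2 unfolding submodule_def by blast
    show "projection N P m1 + projection N P m2 \<in> P"
      using submodule_P 1 2 unfolding submodule_def by blast
    \<comment> \<open>\<open>m1\<close> and \<open>m2\<close> recur inside the projections on the
      right, so \<open>1(3)\<close> and \<open>2(3)\<close> would loop as rewrite rules. Congruence
      applies each of them once.\<close>
    have "m1 + m2 = (n1 + projection N P m1) + (n2 + projection N P m2)"
      by (rule arg_cong2[OF 1(3) 2(3)])
    then show "m1 + m2 = n1 + n2 + (projection N P m1 + projection N P m2)"
      by (simp add: algebra_simps)
  qed
qed

lemma projection_act: "projection N P (m \<cdot> a) = projection N P m \<cdot> a"
proof -
  obtain n where n: "n \<in> N" "projection N P m \<in> P" "m = n + projection N P m"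
    by (rule decompose)
  show ?thesis
  proof (rule projection_eqI)
    show "n \<cdot> a \<in> N"
      using submodule_N n unfolding submodule_def by blast
    show "projection N P m \<cdot> a \<in> P"
      using submodule_P n unfolding submodule_def by blast
    show "m \<cdot> a = n \<cdot> a + projection N P m \<cdot> a"
      using act_add_left[of n "projection N P m" a] unfolding n(3)[symmetric] .
  qed
qed

text \<open>The decomposition is \<open>n + 0\<close>, since 0 lies in the submodule
  \<open>P\<close>.\<close>

lemma projection_eq_0: "n \<in> N \<Longrightarrow> projection N P n = 0"
  using submodule_P by (intro projection_eqI[of n]) (auto simp: submodule_def)

end

locale pseudo_riemannian_embedding =
  isometric_embedding C h C' h' \<phi> \<psi> psihat + source: pseudo_riemannian_calculus C h nabla
  for C :: "('a::star_algebra, 'm::ab_group_add) calculus"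
    and h :: "'m \<Rightarrow> 'm \<Rightarrow> 'a"
    and C' :: "('b::star_algebra, 'n::ab_group_add) calculus"
    and h' :: "'n \<Rightarrow> 'n \<Rightarrow> 'b"
    and \<phi> :: "'a \<Rightarrow> 'b"
    and \<psi> :: "('b \<Rightarrow> 'b) \<Rightarrow> ('a \<Rightarrow> 'a)"
    and psihat :: "'m \<Rightarrow> 'n"
    and nabla :: "('a \<Rightarrow> 'a) \<Rightarrow> 'm \<Rightarrow> 'm"
begin

abbreviation \<alpha> :: "('b \<Rightarrow> 'b) \<Rightarrow> 'm \<Rightarrow> 'm" where
  "\<alpha> \<equiv> second_fundamental_form C h nabla C' \<psi>"

lemma submodule_M_Psi: "submodule C (M_Psi C C' \<psi>)"
  unfolding M_Psi_def by (rule submodule_submodule_generated)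

sublocale submodule_decomposition C "M_Psi C C' \<psi>" "orth_compl h (M_Psi C C' \<psi>)"
  by unfold_locales (rule submodule_M_Psi source.submodule_orth_compl orthogonal_decomposition)+

lemma psi_ders: "\<delta> \<in> ders C' \<Longrightarrow> \<psi> \<delta> \<in> ders C"
  using psi_hom unfolding lie_hom_on_def by blast

lemma Psi_in_M_Psi: "\<delta> \<in> ders C' \<Longrightarrow> Psi C \<psi> \<delta> \<in> M_Psi C C' \<psi>"
  unfolding M_Psi_def by (rule subsetD[OF submodule_generated_superset]) simp

lemma second_fundamental_form_symmetric:
  assumes "\<delta>1 \<in> ders C'" "\<delta>2 \<in> ders C'"
  shows "\<alpha> \<delta>1 (Psi C \<psi> \<delta>2) = \<alpha> \<delta>2 (Psi C \<psi> \<delta>1)"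
proof -
  have "der_bracket (\<psi> \<delta>1) (\<psi> \<delta>2) = \<psi> (der_bracket \<delta>1 \<delta>2)"
    using psi_hom assms unfolding lie_hom_on_def by simp
  then have "nabla (\<psi> \<delta>1) (Psi C \<psi> \<delta>2) - nabla (\<psi> \<delta>2) (Psi C \<psi> \<delta>1) = Psi C \<psi> (der_bracket \<delta>1 \<delta>2)"
    using source.nabla_torsion_free[OF psi_ders psi_ders, OF assms] by (simp add: Psi_def)
  then have "nabla (\<psi> \<delta>1) (Psi C \<psi> \<delta>2) = Psi C \<psi> (der_bracket \<delta>1 \<delta>2) + nabla (\<psi> \<delta>2) (Psi C \<psi> \<delta>1)"
    by (simp add: diff_eq_eq)
  \<comment> \<open>Closure of the target Lie algebra under brackets puts the \<open>Psi\<close>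
    term in \<open>M_Psi\<close>, where the projection kills it.\<close>
  moreover have "der_bracket \<delta>1 \<delta>2 \<in> ders C'"
    using target.ders_lie assms by (rule lie_algebra_of_derivations_bracket)
  ultimately show ?thesis
    by (simp add: second_fundamental_form_def projection_add projection_eq_0 Psi_in_M_Psi)
qed

text \<open>Linearity passes through \<open>\<psi>\<close>, then \<open>nabla\<close>, then the
  projection. The real scalars of \<open>mscale\<close> act as algebra elements r1, so
  \<open>projection_act\<close> covers them.\<close>

lemma second_fundamental_form_linear_left:
  assumes "\<delta>1 \<in> ders C'" "\<delta>2 \<in> ders C'"
  shows "\<alpha> (der_scale l1 \<delta>1 + der_scale l2 \<delta>2) m = mscale C l1 (\<alpha> \<delta>1 m) + mscale C l2 (\<alpha> \<delta>2 m)"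
proof -
  have "real_linear_on (ders C') der_scale der_scale \<psi>"
    using psi_hom unfolding lie_hom_on_def by blast
  note real_linear_on_lincomb[OF this target.ders_lie assms, of l1 l2]
  moreover note real_linear_on_lincomb[OF source.nabla_linear source.ders_lie psi_ders psi_ders,
      OF assms, of l1 l2 m]
  ultimately show ?thesis
    by (simp add: second_fundamental_form_def mscale_def projection_add projection_act)
qed

lemma second_fundamental_form_add:
  assumes "\<delta> \<in> ders C'"
  shows "\<alpha> \<delta> (m1 + m2) = \<alpha> \<delta> m1 + \<alpha> \<delta> m2"
  using assms
  by (simp add: second_fundamental_form_def source.nabla_add psi_ders projection_add)

lemma second_fundamental_form_act:
  assumes "\<delta> \<in> ders C'" "m \<in> M_Psi C C' \<psi>"
  shows "\<alpha> \<delta> (m \<cdot>\<^bsub>C\<^esub> a) = \<alpha> \<delta> m \<cdot>\<^bsub>C\<^esub> a"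
proof -
  have "m \<cdot>\<^bsub>C\<^esub> \<psi> \<delta> a \<in> M_Psi C C' \<psi>"
    using submodule_M_Psi assms(2) unfolding submodule_def by blast
  then show ?thesis
    \<comment> \<open>\<open>projection_act\<close> is instantiated so that it leaves the derivative
      term alone. In general form it would also pull \<open>\<psi> \<delta> a\<close> out of that
      projection, and \<open>projection_eq_0\<close> would no longer match the membership just
      shown.\<close>
    using assms(1) by (simp add: second_fundamental_form_def source.nabla_act psi_ders
        projection_add projection_act[of "nabla (\<psi> \<delta>) m"] projection_eq_0)
qed

end

theorem proposition4p4:
  fixes C :: "('a::star_algebra, 'm::ab_group_add) calculus"
    and C' :: "('b::star_algebra, 'n::ab_group_add) calculus"
    and h :: "'m \<Rightarrow> 'm \<Rightarrow> 'a" and h' :: "'n \<Rightarrow> 'n \<Rightarrow> 'b"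
    and nabla :: "('a \<Rightarrow> 'a) \<Rightarrow> 'm \<Rightarrow> 'm" and nabla' :: "('b \<Rightarrow> 'b) \<Rightarrow> 'n \<Rightarrow> 'n"
    and \<phi> :: "'a \<Rightarrow> 'b" and \<psi> :: "('b \<Rightarrow> 'b) \<Rightarrow> ('a \<Rightarrow> 'a)" and psihat :: "'m \<Rightarrow> 'n"
    and \<delta>1 \<delta>2 :: "'b \<Rightarrow> 'b" and a1 a2 :: 'a and l1 l2 :: real and m1 m2 :: 'm
    and \<alpha> :: "('b \<Rightarrow> 'b) \<Rightarrow> 'm \<Rightarrow> 'm"
  assumes "pseudo_riemannian_calculus C h nabla"
    and "pseudo_riemannian_calculus C' h' nabla'"
    and "isometric_embedding C h C' h' \<phi> \<psi> psihat"
    and "\<alpha> = second_fundamental_form C h nabla C' \<psi>"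
    and "\<delta>1 \<in> ders C'" and "\<delta>2 \<in> ders C'"
    and "m1 \<in> M_Psi C C' \<psi>" and "m2 \<in> M_Psi C C' \<psi>"
  shows "\<alpha> \<delta>1 (Psi C \<psi> \<delta>2) = \<alpha> \<delta>2 (Psi C \<psi> \<delta>1) \<and>
    \<alpha> (der_scale l1 \<delta>1 + der_scale l2 \<delta>2) m1 = mscale C l1 (\<alpha> \<delta>1 m1) + mscale C l2 (\<alpha> \<delta>2 m1) \<and>
    \<alpha> \<delta>1 (m1 \<cdot>\<^bsub>C\<^esub> a1 + m2 \<cdot>\<^bsub>C\<^esub> a2) = \<alpha> \<delta>1 m1 \<cdot>\<^bsub>C\<^esub> a1 + \<alpha> \<delta>1 m2 \<cdot>\<^bsub>C\<^esub> a2"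
proof -
  interpret pseudo_riemannian_embedding C h C' h' \<phi> \<psi> psihat nabla
    by (intro pseudo_riemannian_embedding.intro assms)
  show ?thesis
    \<comment> \<open>These rewrites make both sides of the third equation identical.\<close>
    unfolding assms(4) second_fundamental_form_add[OF assms(5)]
      second_fundamental_form_act[OF assms(5,7)] second_fundamental_form_act[OF assms(5,8)]
    using second_fundamental_form_symmetric[OF assms(5,6)]
      second_fundamental_form_linear_left[OF assms(5,6)]
    by blast
qed

end
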